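(* Let $R$ be a $3$-row graph with $R_C$ being eulerian. Suppose that for some $i\in\{1,2,3\}$, at most one component of $R[V_i]$ has more than one vertex. Moreover, suppose that every column of $R$ which contains an isolated vertex of $R[V_i]$ has the following property: there is at most one vertex $v$ in the column such that $d(v,R)\neq 0$. Then $R$ has an amiable coloring.
   Context: All graphs are finite and loopless; parallel edges are allowed. A graph (not necessarily connected) is eulerian if every vertex has even degree. $d(v,R)$ is the degree of $v$ in $R$, $E_v$ is the set of edges incident with $v$; given an edge-coloring, $d_c(v,R)$ is the number of edges of color $c$ of $R$ incident with $v$. Colorings need not be proper; $3$-colorings use the colors $1,2,3$. A $3$-row graph $R$ is a graph with vertices $v_{ij}$, $1\le i\le 3$, $1\le j\le s$, such that each column $C_j:=\{v_{1j},v_{2j},v_{3j}\}$ is an independent set of $R$. $V_i:=\{v_{ij}:1\le j\le s\}$ is the vertex set of the $i$-th row. $R_C$ is the graph with vertex set $\{c_1,\dots,c_s\}$ obtained from $R$ by identifying, for each $j$, all vertices of $C_j$ to the single vertex $c_j$ (parallel edges are kept). An amiable coloring of a $3$-row graph $R$ is a $3$-vertex-coloring $f$ together with a $3$-edge-coloring $g$ such that for all $i\in\{1,2,3\}$ and $j\in\{1,\dots,s\}$: (i) $f(v)\ne f(w)$ for all $v\neq w$ in $C_j$; (ii) $f(v)\neq g(e)$ for every $v\in V(R)$ and every $e\in E_v$; (iii) $d_i(v_{1j},R)+d_i(v_{2j},R)+d_i(v_{3j},R)$ is even. *)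

theory Defs
  imports Main
begin

text \<open>
  Undirected multigraphs: edges are abstract objects, and \<open>ends\<close> sends an edge to the set of its
  end-vertices. It need not be injective, so parallel edges are allowed; requiring exactly two
  ends rules out loops.
\<close>

record ('v, 'e) mgraph =
  verts :: "'v set"
  edges :: "'e set"
  ends :: "'e \<Rightarrow> 'v set"

definition multigraph :: "('v, 'e) mgraph \<Rightarrow> bool" where
  "multigraph G \<longleftrightarrow> finite (verts G) \<and> finite (edges G) \<and>
     (\<forall>e\<in>edges G. ends G e \<subseteq> verts G \<and> card (ends G e) = 2)"

definition incident_edges :: "('v, 'e) mgraph \<Rightarrow> 'v \<Rightarrow> 'e set" where
  "incident_edges G v = {e \<in> edges G. v \<in> ends G e}"

definition degree :: "('v, 'e) mgraph \<Rightarrow> 'v \<Rightarrow> nat" where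
  "degree G v = card (incident_edges G v)"

definition color_degree :: "('v, 'e) mgraph \<Rightarrow> ('e \<Rightarrow> nat) \<Rightarrow> nat \<Rightarrow> 'v \<Rightarrow> nat" where
  "color_degree G g c v = card {e \<in> incident_edges G v. g e = c}"

definition eulerian :: "('v, 'e) mgraph \<Rightarrow> bool" where
  "eulerian G \<longleftrightarrow> multigraph G \<and> (\<forall>v\<in>verts G. even (degree G v))"

definition isolated_vertex :: "('v, 'e) mgraph \<Rightarrow> 'v \<Rightarrow> bool" where
  "isolated_vertex G v \<longleftrightarrow> v \<in> verts G \<and> degree G v = 0"

definition independent_set :: "('v, 'e) mgraph \<Rightarrow> 'v set \<Rightarrow> bool" where
  "independent_set G S \<longleftrightarrow> S \<subseteq> verts G \<and> (\<forall>e\<in>edges G. \<not> ends G e \<subseteq> S)"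

definition induced_subgraph :: "('v, 'e) mgraph \<Rightarrow> 'v set \<Rightarrow> ('v, 'e) mgraph" where
  "induced_subgraph G S =
     \<lparr>verts = S, edges = {e \<in> edges G. ends G e \<subseteq> S}, ends = ends G\<rparr>"

definition adjacency :: "('v, 'e) mgraph \<Rightarrow> ('v \<times> 'v) set" where
  "adjacency G = {(u, w). \<exists>e\<in>edges G. ends G e = {u, w}}"

text \<open>Components are represented by their vertex sets.\<close>

definition components :: "('v, 'e) mgraph \<Rightarrow> 'v set set" where
  "components G = verts G // (adjacency G)\<^sup>*"

text \<open>
  The vertex in row \<open>i\<close> and column \<open>j\<close> of a 3-row graph is the pair \<open>(i, j)\<close>.
\<close>

definition column :: "nat \<Rightarrow> (nat \<times> nat) set" where
  "column j = {1..3} \<times> {j}"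

definition row :: "nat \<Rightarrow> nat \<Rightarrow> (nat \<times> nat) set" where
  "row s i = {i} \<times> {1..s}"

definition three_row_graph :: "nat \<Rightarrow> (nat \<times> nat, 'e) mgraph \<Rightarrow> bool" where
  "three_row_graph s R \<longleftrightarrow> multigraph R \<and> verts R = {1..3} \<times> {1..s} \<and>
     (\<forall>j\<in>{1..s}. independent_set R (column j))"

text \<open>
  Identifying the vertices of each column: the edge set is kept and every end-vertex \<open>(i, j)\<close> is
  renamed to \<open>j\<close>, so edges may become parallel, but since columns are independent none becomes
  a loop.
\<close>

definition column_graph :: "(nat \<times> nat, 'e) mgraph \<Rightarrow> (nat, 'e) mgraph" where
  "column_graph R =
     \<lparr>verts = snd ` verts R, edges = edges R, ends = (\<lambda>e. snd ` ends R e)\<rparr>"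

definition amiable_coloring ::
  "nat \<Rightarrow> (nat \<times> nat, 'e) mgraph \<Rightarrow> (nat \<times> nat \<Rightarrow> nat) \<Rightarrow> ('e \<Rightarrow> nat) \<Rightarrow> bool" where
  "amiable_coloring s R f g \<longleftrightarrow>
     f ` verts R \<subseteq> {1, 2, 3} \<and> g ` edges R \<subseteq> {1, 2, 3} \<and>
     (\<forall>j\<in>{1..s}. \<forall>v\<in>column j. \<forall>w\<in>column j. v \<noteq> w \<longrightarrow> f v \<noteq> f w) \<and>
     (\<forall>v\<in>verts R. \<forall>e\<in>incident_edges R v. f v \<noteq> g e) \<and>
     (\<forall>c\<in>{1, 2, 3}. \<forall>j\<in>{1..s}.
        even (color_degree R g c (1, j) + color_degree R g c (2, j) + color_degree R g c (3, j)))"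

end

theory Submission
  imports Defs
begin

text \<open>
  Since every column has even total degree, only two of the three colors have to be made even at
  each column. Color \<open>1\<close> is handled by the choice of the vertex-coloring, color \<open>2\<close> afterwards by
  recoloring edges of row \<open>i\<close>.

  In every column exactly one vertex, called special, gets color \<open>1\<close>: normally the one in row \<open>i\<close>,
  but if that vertex is isolated in \<open>R[V\<^sub>i]\<close>, a vertex of degree \<open>0\<close> in \<open>R\<close>. The other two
  vertices of column \<open>j\<close> get the colors \<open>2\<close> and \<open>3\<close>, in an order given by a bit \<open>x j\<close>. Color \<open>1\<close> can
  then only be used on the set \<open>H\<close> of edges between non-special vertices, and it must be used on
  those edges of \<open>H\<close> whose ends got different colors. So one needs a subset \<open>Y\<close> of \<open>H\<close>, even at
  every column, and bits \<open>x\<close> such that every edge of \<open>H - Y\<close> has ends of equal color. For this,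
  take \<open>Y\<close> to be a maximal even subset of \<open>H\<close>, with columns as vertices. Its complement in \<open>H\<close> is
  a forest, and on a forest every prescription of \<open>x u + x w\<close> along the edges can be met
  (\<open>even_set_balanced_complement\<close>).

  Every other edge with a non-special end now has no choice between \<open>2\<close> and \<open>3\<close>, while the set \<open>M\<close>
  of edges between special vertices may use both. Color \<open>M\<close> with \<open>3\<close> at first and let \<open>T\<close> be the
  set of columns where color \<open>2\<close> is odd; by the handshake lemma \<open>T\<close> has even size. Columns
  whose vertex in row \<open>i\<close> is isolated in \<open>R[V\<^sub>i]\<close> are not in \<open>T\<close>: all their edges meet a
  single vertex, at which its own color does not occur, and color \<open>1\<close> and the total are even. So
  \<open>T\<close> lies in the unique nontrivial component of \<open>R[V\<^sub>i]\<close>, whose edges belong to \<open>M\<close>; a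
  \<open>T\<close>-join inside \<open>M\<close> (\<open>join_exists\<close>), recolored from \<open>3\<close> to \<open>2\<close>, makes color \<open>2\<close> even
  everywhere.
\<close>

section \<open>Degree parities of edge sets\<close>

text \<open>
  Edge sets are measured against an arbitrary end map \<open>p\<close>, so that the same edges can be viewed
  both in \<open>R\<close> and, with ends projected to columns, in \<open>R\<^sub>C\<close>.
\<close>

definition odd_at :: "('e \<Rightarrow> 'v set) \<Rightarrow> 'e set \<Rightarrow> 'v \<Rightarrow> bool" where
  "odd_at p F v \<longleftrightarrow> odd (card {e \<in> F. v \<in> p e})"

definition adj :: "('e \<Rightarrow> 'v set) \<Rightarrow> 'e set \<Rightarrow> ('v \<times> 'v) set" where
  "adj p A = {(u, w). \<exists>e\<in>A. p e = {u, w}}"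

lemma odd_card_sym_diff:
  assumes "finite A" "finite B"
  shows "odd (card (A - B \<union> (B - A))) \<longleftrightarrow> odd (card A) \<noteq> odd (card B)"
proof -
  have "card A = card (A - B) + card (A \<inter> B)" "card B = card (B - A) + card (A \<inter> B)"
    using card_Int_Diff[of A B] card_Int_Diff[of B A] assms by (simp_all add: Int_commute)
  moreover have "card (A - B \<union> (B - A)) = card (A - B) + card (B - A)"
    using assms by (intro card_Un_disjoint) auto
  ultimately show ?thesis by presburger
qed

text \<open>
  Modulo 2 the degree is linear on the space of edge sets with symmetric difference as addition.
\<close>

lemma odd_at_sym_diff:
  assumes "finite A" "finite B"
  shows "odd_at p (A - B \<union> (B - A)) v \<longleftrightarrow> odd_at p A v \<noteq> odd_at p B v"
proof -
  let ?I = "\<lambda>F. {e \<in> F. v \<in> p e}"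
  have "?I (A - B \<union> (B - A)) = ?I A - ?I B \<union> (?I B - ?I A)" by blast
  then show ?thesis
    unfolding odd_at_def using odd_card_sym_diff[of "?I A" "?I B"] assms by simp
qed

lemma odd_at_empty [simp]: "\<not> odd_at p {} v"
  by (simp add: odd_at_def)

lemma odd_at_single [simp]: "odd_at p {e} v \<longleftrightarrow> v \<in> p e"
proof -
  have "{e' \<in> {e}. v \<in> p e'} = (if v \<in> p e then {e} else {})" by auto
  then show ?thesis by (simp add: odd_at_def)
qed

lemma odd_at_obtains_edge:
  assumes "odd_at p F v"
  obtains e where "e \<in> F" "v \<in> p e"
proof -
  have "{e \<in> F. v \<in> p e} \<noteq> {}"
    using assms unfolding odd_at_def by (metis card.empty even_zero)
  then show ?thesis using that by blast
qed

lemma odd_at_insert: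
  assumes "finite F" "e \<notin> F"
  shows "odd_at p (insert e F) v \<longleftrightarrow> odd_at p F v \<noteq> (v \<in> p e)"
proof -
  have "insert e F = F - {e} \<union> ({e} - F)" using assms by auto
  then show ?thesis using odd_at_sym_diff[of F "{e}" p v] assms by simp
qed

lemma odd_at_Un_disjoint:
  assumes "finite A" "finite B" "A \<inter> B = {}"
  shows "odd_at p (A \<union> B) v \<longleftrightarrow> odd_at p A v \<noteq> odd_at p B v"
proof -
  have "A \<union> B = A - B \<union> (B - A)" using assms by auto
  then show ?thesis using odd_at_sym_diff[OF assms(1,2), of p v] by simp
qed

text \<open>
  Adding an edge toggles the membership of both of its ends in the set of odd vertices.
\<close>

lemma handshake:
  assumes "finite F" "\<forall>e\<in>F. card (p e) = 2"
  shows "finite {v. odd_at p F v} \<and> even (card {v. odd_at p F v})"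
  using assms
proof (induction F rule: finite_induct)
  case empty
  then show ?case by simp
next
  case (insert e F)
  let ?O = "{v. odd_at p F v}"
  have *: "{v. odd_at p (insert e F) v} = ?O - p e \<union> (p e - ?O)"
    by (auto simp: odd_at_insert[OF insert(1,2)])
  have "finite (p e)" using insert.prems by (metis card.infinite insertI1 zero_neq_numeral)
  moreover have "finite ?O" "even (card ?O)" "card (p e) = 2" using insert by auto
  ultimately show ?case unfolding * using odd_card_sym_diff[of ?O "p e"] by simp
qed

section \<open>Joins\<close>

text \<open>
  A walk from \<open>u\<close> to \<open>w\<close>, with its edges added modulo 2, is odd exactly at its two ends (and
  nowhere if \<open>u = w\<close>).
\<close>

lemma path_join:
  assumes "finite A" "(u, w) \<in> (adj p A)\<^sup>*"
  shows "\<exists>F\<subseteq>A. \<forall>v. odd_at p F v \<longleftrightarrow> (v = u) \<noteq> (v = w)"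
  using assms(2)
proof (induction rule: rtrancl_induct)
  case base
  show ?case by (intro exI[of _ "{}"]) simp
next
  case (step y z)
  obtain F where F: "F \<subseteq> A" "\<forall>v. odd_at p F v \<longleftrightarrow> (v = u) \<noteq> (v = y)"
    using step.IH by blast
  obtain e where e: "e \<in> A" "p e = {y, z}" using step.hyps(2) by (auto simp: adj_def)
  show ?case
  proof (cases "y = z")
    case True
    then show ?thesis using F by auto
  next
    case False
    have "finite F" using F(1) assms(1) by (auto intro: finite_subset)
    then have "\<forall>v. odd_at p (F - {e} \<union> ({e} - F)) v \<longleftrightarrow> (v = u) \<noteq> (v = z)"
      using F(2) False by (auto simp: odd_at_sym_diff e(2))
    moreover have "F - {e} \<union> ({e} - F) \<subseteq> A" using F e by auto
    ultimately show ?thesis by blast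
  qed
qed

text \<open>
  The existence of \<open>T\<close>-joins: pair up the elements of \<open>T\<close> and add the joining walks modulo 2.
\<close>

lemma join_exists:
  assumes "finite A" "finite T" "even (card T)" "\<forall>u\<in>T. \<forall>w\<in>T. (u, w) \<in> (adj p A)\<^sup>*"
  shows "\<exists>F\<subseteq>A. \<forall>v. odd_at p F v \<longleftrightarrow> v \<in> T"
  using assms(2-)
proof (induction "card T" arbitrary: T rule: less_induct)
  case less
  show ?case
  proof (cases "T = {}")
    case True
    then show ?thesis by (intro exI[of _ "{}"]) simp
  next
    case False
    then obtain u where u: "u \<in> T" by blast
    have "T \<noteq> {u}" using less.prems(2) by auto
    then obtain w where w: "w \<in> T" "w \<noteq> u" using u by blast
    let ?S = "T - {u, w}"
    have card: "card T = card ?S + 2"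
      using u w less.prems(1) card_Diff_subset[of "{u, w}" T] card_mono[of T "{u, w}"] by auto
    then have "\<exists>F\<subseteq>A. \<forall>v. odd_at p F v \<longleftrightarrow> v \<in> ?S"
      using less.prems by (intro less.hyps) auto
    then obtain F where F: "F \<subseteq> A" "\<forall>v. odd_at p F v \<longleftrightarrow> v \<in> ?S" by blast
    obtain P where P: "P \<subseteq> A" "\<forall>v. odd_at p P v \<longleftrightarrow> (v = u) \<noteq> (v = w)"
      using path_join[OF assms(1), of u w p] u w less.prems(3) by blast
    have "finite F" "finite P" using F(1) P(1) assms(1) by (auto intro: finite_subset)
    then have "\<forall>v. odd_at p (F - P \<union> (P - F)) v \<longleftrightarrow> v \<in> T"
      using F(2) P(2) u w by (auto simp: odd_at_sym_diff)
    moreover have "F - P \<union> (P - F) \<subseteq> A" using F P by auto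
    ultimately show ?thesis by blast
  qed
qed

section \<open>Even edge sets with balanced complement\<close>

text \<open>
  An edge set without a nonempty even subset is a forest. Adding the edges one by one, each new
  edge joins two different components, for otherwise it would close a cycle; the wanted relation
  between its ends is then obtained by negating \<open>x\<close> on one of these components if necessary.
\<close>

lemma forest_balanced:
  fixes p :: "'e \<Rightarrow> 'v set" and \<sigma> :: "'e \<Rightarrow> bool"
  assumes "finite A" "\<forall>e\<in>A. card (p e) = 2"
    and "\<And>F. F \<subseteq> A \<Longrightarrow> \<forall>v. \<not> odd_at p F v \<Longrightarrow> F = {}"
  shows "\<exists>x :: 'v \<Rightarrow> bool. \<forall>e\<in>A. \<forall>u w. p e = {u, w} \<longrightarrow> (x u \<noteq> x w) = \<sigma> e"
  using assms
proof (induction A rule: finite_induct)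
  case empty
  then show ?case by simp
next
  case (insert e A)
  have "\<exists>x :: 'v \<Rightarrow> bool. \<forall>e\<in>A. \<forall>u w. p e = {u, w} \<longrightarrow> (x u \<noteq> x w) = \<sigma> e"
    using insert.prems by (intro insert.IH) blast+
  then obtain x :: "'v \<Rightarrow> bool"
    where x: "\<forall>e\<in>A. \<forall>u w. p e = {u, w} \<longrightarrow> (x u \<noteq> x w) = \<sigma> e" by blast
  obtain a b where ab: "p e = {a, b}" "a \<noteq> b"
    using insert.prems(1) by (metis card_2_iff insertI1)
  \<comment> \<open>A join of the ends of the new edge would form an even set together with that edge.\<close>
  have "(a, b) \<notin> (adj p A)\<^sup>*"
  proof
    assume "(a, b) \<in> (adj p A)\<^sup>*"
    then obtain F where F: "F \<subseteq> A" "\<forall>v. odd_at p F v \<longleftrightarrow> (v = a) \<noteq> (v = b)"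
      using path_join[OF insert.hyps(1), of a b p] by auto
    have "finite F" "e \<notin> F" using F(1) insert.hyps by (auto intro: finite_subset)
    then have "\<forall>v. \<not> odd_at p (insert e F) v"
      using F(2) ab by (auto simp: odd_at_insert)
    then show False using insert.prems(2)[of "insert e F"] F(1) by blast
  qed
  define C where "C = (adj p A)\<^sup>* `` {a}"
  define flip where "flip = ((x a \<noteq> x b) \<noteq> \<sigma> e)"
  define y where "y v = (x v \<noteq> (flip \<and> v \<in> C))" for v
  have C: "a \<in> C" "b \<notin> C" using \<open>(a, b) \<notin> _\<close> by (auto simp: C_def)
  have closed: "u \<in> C \<longleftrightarrow> w \<in> C" if "e' \<in> A" "p e' = {u, w}" for e' u w
  proof -
    have "(u, w) \<in> adj p A" "(w, u) \<in> adj p A"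
      using that by (auto simp: adj_def insert_commute)
    then show ?thesis unfolding C_def by (meson Image_singleton_iff rtrancl.rtrancl_into_rtrancl)
  qed
  have "(y u \<noteq> y w) = \<sigma> e'" if "e' \<in> insert e A" "p e' = {u, w}" for e' u w
  proof (cases "e' = e")
    case True
    then have "u = a \<and> w = b \<or> u = b \<and> w = a" using that(2) ab by (auto simp: doubleton_eq_iff)
    then show ?thesis using C True by (auto simp: y_def flip_def)
  next
    case False
    then have "e' \<in> A" using that(1) by blast
    then show ?thesis using x that(2) closed[OF _ that(2)] by (auto simp: y_def)
  qed
  then show ?case by (intro exI[of _ y] ballI allI impI)
qed

text \<open>
  In a signed graph the edges outside a suitable even set are balanced: after removing a maximal
  even set, no nonempty even set is left, since it could be added.
\<close>

lemma even_set_balanced_complement: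
  fixes p :: "'e \<Rightarrow> 'v set" and \<sigma> :: "'e \<Rightarrow> bool"
  assumes "finite A" "\<forall>e\<in>A. card (p e) = 2"
  obtains Y and x :: "'v \<Rightarrow> bool" where "Y \<subseteq> A" "\<forall>v. \<not> odd_at p Y v"
    "\<forall>e\<in>A - Y. \<forall>u w. p e = {u, w} \<longrightarrow> (x u \<noteq> x w) = \<sigma> e"
proof -
  let ?E = "{Y \<in> Pow A. \<forall>v. \<not> odd_at p Y v}"
  have "finite ?E" "{} \<in> ?E" using assms(1) by auto
  then obtain Y where Y: "Y \<in> ?E" and max: "\<forall>Z\<in>?E. Y \<subseteq> Z \<longrightarrow> Y = Z"
    using finite_has_maximal[of ?E] by (elim meta_impE) auto
  have fin: "finite Y" using Y assms(1) by (auto intro: finite_subset)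
  have "F = {}" if F: "F \<subseteq> A - Y" "\<forall>v. \<not> odd_at p F v" for F
  proof -
    have "finite F" using F(1) assms(1) by (auto intro: finite_subset)
    moreover have "Y \<inter> F = {}" using F(1) by blast
    ultimately have "Y \<union> F \<in> ?E" using Y F fin by (auto simp: odd_at_Un_disjoint)
    then have "Y = Y \<union> F" using max by blast
    then show ?thesis using F(1) by blast
  qed
  then obtain x :: "'v \<Rightarrow> bool"
    where "\<forall>e\<in>A - Y. \<forall>u w. p e = {u, w} \<longrightarrow> (x u \<noteq> x w) = \<sigma> e"
    using forest_balanced[of "A - Y" p \<sigma>] assms by auto
  then show ?thesis using that[of Y x] Y by auto
qed

section \<open>Edges at a column\<close>

abbreviation col_ends :: "('a \<times> 'v, 'e) mgraph \<Rightarrow> 'e \<Rightarrow> 'v set" where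
  "col_ends R e \<equiv> snd ` ends R e"

lemma three_row_edge:
  assumes "three_row_graph s R" "e \<in> edges R"
  obtains r j q k where "ends R e = {(r, j), (q, k)}" "j \<noteq> k"
    "r \<in> {1..3}" "q \<in> {1..3}" "j \<in> {1..s}" "k \<in> {1..s}"
proof -
  have *: "ends R e \<subseteq> {1..3} \<times> {1..s}" "card (ends R e) = 2"
    using assms by (auto simp: three_row_graph_def multigraph_def)
  then obtain v w where vw: "ends R e = {v, w}" using card_2_iff by metis
  obtain r j q k where rj: "v = (r, j)" and qk: "w = (q, k)" by fastforce
  have in_range: "r \<in> {1..3}" "q \<in> {1..3}" "j \<in> {1..s}" "k \<in> {1..s}"
    using *(1) vw rj qk by auto
  have "\<not> ends R e \<subseteq> column j"
    using assms in_range unfolding three_row_graph_def independent_set_def by blast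
  then have "j \<noteq> k" using vw rj qk in_range by (auto simp: column_def)
  then show ?thesis using that vw rj qk in_range by blast
qed

text \<open>
  Since columns are independent, no edge is counted at two vertices of a column, so the color sum
  over a column is a degree in \<open>R\<^sub>C\<close>.
\<close>

lemma column_color_count:
  assumes "three_row_graph s R" "j \<in> {1..s}"
  shows "color_degree R g c (1, j) + color_degree R g c (2, j) + color_degree R g c (3, j)
    = card {e \<in> {e \<in> edges R. g e = c}. j \<in> col_ends R e}"
proof -
  let ?D = "\<lambda>r. {e \<in> incident_edges R (r, j). g e = c}"
  have fin: "finite (?D r)" for r
    using assms by (auto simp: three_row_graph_def multigraph_def incident_edges_def)
  have disj: "?D r \<inter> ?D q = {}" if "r \<noteq> q" for r q
  proof -
    have False if "e \<in> edges R" "(r, j) \<in> ends R e" "(q, j) \<in> ends R e" for e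
      by (rule three_row_edge[OF assms(1) that(1)]) (use that(2,3) \<open>r \<noteq> q\<close> in auto)
    then show ?thesis by (auto simp: incident_edges_def)
  qed
  have "{e \<in> {e \<in> edges R. g e = c}. j \<in> col_ends R e} = ?D 1 \<union> ?D 2 \<union> ?D 3" (is "?L = ?U")
  proof
    show "?L \<subseteq> ?U"
    proof
      fix e assume e: "e \<in> ?L"
      then obtain r where r: "(r, j) \<in> ends R e" by force
      have "ends R e \<subseteq> {1..3} \<times> {1..s}"
        using e assms(1) by (auto simp: three_row_graph_def multigraph_def)
      then have "r \<in> {1..3}" using r by blast
      then have "r = 1 \<or> r = 2 \<or> r = 3" by auto
      then show "e \<in> ?U" using e r by (auto simp: incident_edges_def)
    qed
    show "?U \<subseteq> ?L" by (force simp: incident_edges_def)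
  qed
  moreover have "card (?D 1 \<union> ?D 2 \<union> ?D 3) = card (?D 1) + card (?D 2) + card (?D 3)"
  proof -
    have "card (?D 1 \<union> ?D 2) = card (?D 1) + card (?D 2)"
      using fin disj by (intro card_Un_disjoint) auto
    moreover have "card (?D 1 \<union> ?D 2 \<union> ?D 3) = card (?D 1 \<union> ?D 2) + card (?D 3)"
      using fin disj[of 1 3] disj[of 2 3] by (intro card_Un_disjoint) auto
    ultimately show ?thesis by simp
  qed
  ultimately show ?thesis by (simp add: color_degree_def)
qed

text \<open>
  A vertex with an edge in \<open>R[V\<^sub>i]\<close> lies in a component with more than one vertex, and there is
  at most one such component. The connection is stated between columns, where the join is needed.
\<close>

lemma nonisolated_connected:
  fixes R :: "(nat \<times> nat, 'e) mgraph"
  assumes R: "three_row_graph s R"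
    and one: "card {K \<in> components (induced_subgraph R (row s i)). card K > 1} \<le> 1"
    and j: "j \<in> {1..s}" "degree (induced_subgraph R (row s i)) (i, j) \<noteq> 0"
    and k: "k \<in> {1..s}" "degree (induced_subgraph R (row s i)) (i, k) \<noteq> 0"
  shows "(j, k) \<in> (adj (col_ends R) {e \<in> edges R. ends R e \<subseteq> row s i})\<^sup>*"
proof -
  let ?G = "induced_subgraph R (row s i)"
  let ?A = "adjacency ?G"
  have fin_row: "finite (row s i)" by (simp add: row_def)
  have A_row: "?A \<subseteq> row s i \<times> row s i"
    by (auto simp: adjacency_def induced_subgraph_def)
  have sub: "?A\<^sup>* `` {v} \<subseteq> row s i" if "v \<in> row s i" for v
  proof
    fix w assume "w \<in> ?A\<^sup>* `` {v}"
    then have "(v, w) \<in> ?A\<^sup>*" by simp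
    then show "w \<in> row s i" using that A_row by (induction rule: rtrancl_induct) auto
  qed
  have verts: "verts ?G = row s i" by (simp add: induced_subgraph_def)
  have big: "?A\<^sup>* `` {(i, l)} \<in> {K \<in> components ?G. card K > 1}"
    if l: "l \<in> {1..s}" "degree ?G (i, l) \<noteq> 0" for l
  proof -
    have row: "(i, l) \<in> row s i" using l(1) by (simp add: row_def)
    obtain e where e: "e \<in> edges ?G" "(i, l) \<in> ends ?G e"
      using l(2) unfolding degree_def incident_edges_def by (metis (no_types, lifting) card.empty empty_Collect_eq)
    then have "card (ends R e) = 2"
      using R by (auto simp: three_row_graph_def multigraph_def induced_subgraph_def)
    moreover have "(i, l) \<in> ends R e" using e(2) by (simp add: induced_subgraph_def)
    ultimately have "card (ends R e - {(i, l)}) = 1" by simp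
    then obtain w where "ends R e - {(i, l)} = {w}" by (rule card_1_singletonE)
    then have w: "ends R e = {(i, l), w}" "w \<noteq> (i, l)"
      using \<open>(i, l) \<in> ends R e\<close> by blast+
    then have "((i, l), w) \<in> ?A" using e by (auto simp: adjacency_def induced_subgraph_def)
    then have "{(i, l), w} \<subseteq> ?A\<^sup>* `` {(i, l)}" by auto
    moreover have "finite (?A\<^sup>* `` {(i, l)})"
      using sub[OF row] fin_row by (rule finite_subset)
    ultimately have "card {(i, l), w} \<le> card (?A\<^sup>* `` {(i, l)})" by (intro card_mono)
    moreover have "card {(i, l), w} = 2" using w(2) by auto
    moreover have "?A\<^sup>* `` {(i, l)} \<in> components ?G"
      unfolding components_def verts using row by (rule quotientI)
    ultimately show ?thesis by simp
  qed
  have "finite (components ?G)"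
    unfolding components_def quotient_def verts using fin_row by simp
  then have "finite {K \<in> components ?G. card K > 1}" by simp
  then have "?A\<^sup>* `` {(i, j)} = ?A\<^sup>* `` {(i, k)}"
    using one big[OF j] big[OF k] by (simp add: card_le_Suc0_iff_eq)
  then have "((i, j), (i, k)) \<in> ?A\<^sup>*" by blast
  then have "(snd (i, j), snd (i, k)) \<in> (adj (col_ends R) {e \<in> edges R. ends R e \<subseteq> row s i})\<^sup>*"
  proof (induction rule: rtrancl_induct)
    case base
    show ?case by simp
  next
    case (step y z)
    have "(snd y, snd z) \<in> adj (col_ends R) {e \<in> edges R. ends R e \<subseteq> row s i}"
      using step.hyps(2) by (force simp: adjacency_def adj_def induced_subgraph_def)
    then show ?case using step.IH by simp
  qed
  then show ?thesis by simp
qed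

section \<open>The amiable coloring\<close>

text \<open>
  The cyclic successor of the special row \<open>a\<close> tells the two remaining rows of a column apart.
\<close>

lemma next_row:
  fixes a r q :: nat
  assumes "a \<in> {1..3}" "r \<in> {1..3}" "q \<in> {1..3}" "r \<noteq> a" "q \<noteq> a" "r \<noteq> q"
  shows "(r = a mod 3 + 1) \<noteq> (q = a mod 3 + 1)"
proof -
  have "a = 1 \<or> a = 2 \<or> a = 3" "r = 1 \<or> r = 2 \<or> r = 3" "q = 1 \<or> q = 2 \<or> q = 3"
    using assms(1-3) unfolding atLeastAtMost_iff by linarith+
  then show ?thesis using assms(4-6) by (elim disjE) simp_all
qed

theorem corollary19:
  fixes R :: "(nat \<times> nat, 'e) mgraph" and s i :: nat
  assumes "three_row_graph s R"
    and "eulerian (column_graph R)"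
    and "i \<in> {1, 2, 3}"
    and "card {K \<in> components (induced_subgraph R (row s i)). card K > 1} \<le> 1"
    and "\<forall>j\<in>{1..s}. (\<exists>v\<in>column j. isolated_vertex (induced_subgraph R (row s i)) v) \<longrightarrow>
           card {v \<in> column j. degree R v \<noteq> 0} \<le> 1"
  shows "\<exists>f g. amiable_coloring s R f g"
proof -
  note R = assms(1)
  let ?p = "col_ends R"
  have finE: "finite (edges R)" and vertsR: "verts R = {1..3} \<times> {1..s}"
    using R by (auto simp: three_row_graph_def multigraph_def)
  have p2: "\<forall>e\<in>edges R. card (?p e) = 2"
  proof
    fix e assume "e \<in> edges R"
    then show "card (?p e) = 2" by (rule three_row_edge[OF R]) simp
  qed
  have two_ends: "ends R e = {v, w}"
    if "e \<in> edges R" "v \<in> ends R e" "w \<in> ends R e" "v \<noteq> w" for e v w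
    by (rule three_row_edge[OF R that(1)]) (use that(2-4) in auto)
  have total: "\<not> odd_at ?p (edges R) j" if "j \<in> {1..s}" for j
  proof -
    have "j \<in> snd ` verts R" using that by (force simp: vertsR)
    then show ?thesis using assms(2)
      by (auto simp: eulerian_def column_graph_def degree_def incident_edges_def odd_at_def)
  qed

  define iso where "iso j \<longleftrightarrow> degree (induced_subgraph R (row s i)) (i, j) = 0" for j
  have iso_unique: "v = w"
    if "j \<in> {1..s}" "iso j" "v \<in> column j" "w \<in> column j" "degree R v \<noteq> 0" "degree R w \<noteq> 0"
    for j v w
  proof -
    have "(i, j) \<in> column j" "isolated_vertex (induced_subgraph R (row s i)) (i, j)"
      using that(1,2) assms(3)
      by (auto simp: column_def iso_def isolated_vertex_def induced_subgraph_def row_def)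
    then have "card {v \<in> column j. degree R v \<noteq> 0} \<le> Suc 0"
      using assms(5) that(1) by auto
    moreover have "finite {v \<in> column j. degree R v \<noteq> 0}" by (simp add: column_def)
    ultimately show ?thesis using that(3-6) card_le_Suc0_iff_eq by blast
  qed
  \<comment> \<open>The row of the special vertex. In a column with \<open>iso j\<close>, two of the three vertices have
    degree \<open>0\<close>, so a special vertex without edges can be found among the first two.\<close>
  have "\<exists>r\<in>{1..3}. if iso j then degree R (r, j) = 0 else r = i" if j: "j \<in> {1..s}" for j
  proof (cases "iso j")
    case True
    then have "degree R (1, j) = 0 \<or> degree R (2, j) = 0"
      using iso_unique[OF j True, of "(1, j)" "(2, j)"] by (auto simp: column_def)
    then show ?thesis using True by force
  next
    case False
    then show ?thesis using assms(3) by auto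
  qed
  then obtain a where "\<forall>j\<in>{1..s}. a j \<in> {1..3} \<and> (if iso j then degree R (a j, j) = 0 else a j = i)"
    by metis
  then have a: "a j \<in> {1..3}" "iso j \<Longrightarrow> degree R (a j, j) = 0" "\<not> iso j \<Longrightarrow> a j = i"
    if "j \<in> {1..s}" for j using that by (auto split: if_splits)

  define special where "special v \<longleftrightarrow> fst v = a (snd v)" for v
  define side where "side v \<longleftrightarrow> fst v = a (snd v) mod 3 + 1" for v
  \<comment> \<open>On an edge of \<open>H\<close> the ends get equal colors iff \<open>x\<close> differs between its columns exactly
    when \<open>side\<close> differs between its ends, which is the sign \<open>\<sigma>\<close>.\<close>
  define H where "H = {e \<in> edges R. \<forall>v\<in>ends R e. \<not> special v}"
  define \<sigma> where "\<sigma> e \<longleftrightarrow> (\<exists>v\<in>ends R e. side v) \<and> (\<exists>v\<in>ends R e. \<not> side v)" for e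
  have "finite H" "\<forall>e\<in>H. card (?p e) = 2" using finE p2 by (auto simp: H_def)
  from even_set_balanced_complement[OF this, of \<sigma>]
  obtain Y and x :: "nat \<Rightarrow> bool" where Y: "Y \<subseteq> H" "\<forall>j. \<not> odd_at ?p Y j"
    and x: "\<forall>e\<in>H - Y. \<forall>u w. ?p e = {u, w} \<longrightarrow> (x u \<noteq> x w) = \<sigma> e" by blast

  define f :: "nat \<times> nat \<Rightarrow> nat" where
    "f v = (if special v then 1 else if x (snd v) = side v then 2 else 3)" for v
  have f_range: "f v \<in> {1, 2, 3}" for v by (simp add: f_def)
  have f_1: "f v = 1 \<longleftrightarrow> special v" for v by (simp add: f_def)
  have f_inj: "f v \<noteq> f w" if j: "j \<in> {1..s}" and v: "v \<in> column j" and w: "w \<in> column j" and "v \<noteq> w" for j v w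
  proof -
    obtain r q where rq: "v = (r, j)" "w = (q, j)" "r \<in> {1..3}" "q \<in> {1..3}"
      using v w unfolding column_def by blast
    then have "r \<noteq> q" using \<open>v \<noteq> w\<close> by blast
    show ?thesis
    proof (cases "special v \<or> special w")
      case True
      moreover have "special v \<noteq> special w"
        using True \<open>r \<noteq> q\<close> by (auto simp: rq(1,2) special_def)
      ultimately show ?thesis by (auto simp: f_def)
    next
      case False
      then have "side v \<noteq> side w"
        using next_row[OF a(1)[OF j] rq(3,4)] \<open>r \<noteq> q\<close> by (simp add: rq special_def side_def)
      moreover have "x (snd v) = x (snd w)" by (simp add: rq(1,2))
      ultimately show ?thesis
        using False by (cases "side v"; cases "side w"; cases "x (snd w)"; simp add: f_def)
    qed
  qed
  have f_same: "f v = f w" if "e \<in> H - Y" "v \<in> ends R e" "w \<in> ends R e" for e v w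
  proof (cases "v = w")
    case False
    have eR: "e \<in> edges R" and ns: "\<not> special v" "\<not> special w" using that by (auto simp: H_def)
    have vw: "ends R e = {v, w}" using two_ends[OF eR] that(2,3) False by blast
    then have "(x (snd v) \<noteq> x (snd w)) = \<sigma> e" using x that(1) by auto
    moreover have "\<sigma> e \<longleftrightarrow> side v \<noteq> side w"
      unfolding \<sigma>_def vw by blast
    ultimately show ?thesis
      using ns by (cases "side v"; cases "side w"; cases "x (snd w)"; simp add: f_def)
  qed simp

  \<comment> \<open>Outside \<open>Y\<close> the colors \<open>2\<close> and \<open>3\<close> never meet on one edge, so an end of color \<open>3\<close> leaves
    only \<open>2\<close>, and otherwise \<open>3\<close> is available.\<close>
  define g0 :: "'e \<Rightarrow> nat" where
    "g0 e = (if e \<in> Y then 1 else if 3 \<in> f ` ends R e then 2 else 3)" for e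
  define M where "M = {e \<in> edges R. \<forall>v\<in>ends R e. special v}"
  have g0_proper: "f v \<noteq> g0 e" if eR: "e \<in> edges R" and v: "v \<in> ends R e" for e v
  proof (cases "e \<in> Y")
    case True
    then have "\<not> special v" using Y(1) v by (auto simp: H_def)
    then show ?thesis using True f_1[of v] by (simp add: g0_def)
  next
    case False
    consider "f v = 1" | "f v = 2" | "f v = 3" using f_range[of v] by blast
    then show ?thesis
    proof cases
      case 1
      then show ?thesis using False by (simp add: g0_def)
    next
      case 2
      have "f w \<noteq> 3" if w: "w \<in> ends R e" for w
      proof
        assume "f w = 3"
        then have "v \<noteq> w" "\<not> special v" "\<not> special w" using 2 f_1[of v] f_1[of w] by auto
        then have "e \<in> H - Y" using two_ends[OF eR v w] eR False by (simp add: H_def)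
        then show False using f_same[OF _ v w] 2 \<open>f w = 3\<close> by simp
      qed
      then have "3 \<notin> f ` ends R e" by force
      then show ?thesis using 2 False by (simp add: g0_def)
    next
      case 3
      then have "3 \<in> f ` ends R e" using v by force
      then show ?thesis using 3 False by (simp add: g0_def)
    qed
  qed
  have g0_M: "g0 e = 3" if "e \<in> M" for e
  proof -
    have all: "\<forall>v\<in>ends R e. special v" using that by (simp add: M_def)
    then have "3 \<notin> f ` ends R e" by (auto simp: f_def)
    moreover have "ends R e \<noteq> {}" using that p2 by (force simp: M_def)
    then have "e \<notin> Y" using all Y(1) by (auto simp: H_def)
    ultimately show ?thesis by (simp add: g0_def)
  qed

  define T where "T = {j. odd_at ?p {e \<in> edges R. g0 e = 2} j}"
  have T: "finite T" "even (card T)"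
    unfolding T_def using handshake[of "{e \<in> edges R. g0 e = 2}" ?p] finE p2 by auto
  have T_range: "j \<in> {1..s}" if "j \<in> T" for j
  proof -
    have "odd_at ?p {e \<in> edges R. g0 e = 2} j" using that by (simp add: T_def)
    then obtain e where e: "e \<in> edges R" "j \<in> ?p e" by (rule odd_at_obtains_edge) blast
    show ?thesis by (rule three_row_edge[OF R e(1)]) (use e(2) in auto)
  qed
  \<comment> \<open>If \<open>iso j\<close>, all edges at column \<open>j\<close> meet one non-special vertex \<open>v\<close>. If \<open>f v = 2\<close>, color
    \<open>2\<close> does not occur; if \<open>f v = 3\<close>, it occurs on all edges outside \<open>Y\<close>, an even number.\<close>
  have T_noniso: "\<not> iso j" if "j \<in> T" for j
  proof
    assume "iso j"
    note j = T_range[OF that]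
    have deg: "degree R v \<noteq> 0" if "e \<in> edges R" "v \<in> ends R e" for e v
      using that finE by (auto simp: degree_def incident_edges_def)
    have at_j: "\<exists>v. v \<in> ends R e \<and> v \<in> column j \<and> degree R v \<noteq> 0" if eR: "e \<in> edges R" and je: "j \<in> ?p e" for e
    proof -
      obtain v where v: "v \<in> ends R e" "snd v = j" using je by auto
      moreover have "v \<in> verts R"
        using R v eR by (auto simp: three_row_graph_def multigraph_def)
      ultimately show ?thesis using deg[OF eR v(1)] by (auto simp: vertsR column_def)
    qed
    have odd: "odd_at ?p {e \<in> edges R. g0 e = 2} j" using \<open>j \<in> T\<close> by (simp add: T_def)
    then obtain e0 where e0: "e0 \<in> edges R" "j \<in> ?p e0" "g0 e0 = 2"
      by (rule odd_at_obtains_edge) blast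
    obtain v where v: "v \<in> ends R e0" "v \<in> column j" "degree R v \<noteq> 0" using at_j e0 by blast
    have v_end: "v \<in> ends R e" if "e \<in> edges R" "j \<in> ?p e" for e
      using at_j[OF that] iso_unique[OF j \<open>iso j\<close>] v by blast
    have "f v \<noteq> 2" using g0_proper[OF e0(1) v(1)] e0(3) by simp
    moreover have "f v \<noteq> 1"
    proof -
      have "snd v = j" using v(2) by (auto simp: column_def)
      then have "\<not> special v" using a(2)[OF j \<open>iso j\<close>] v(3) by (metis special_def prod.collapse)
      then show ?thesis using f_1 by blast
    qed
    ultimately have "f v = 3" using f_range[of v] by auto
    have "g0 e = 2 \<longleftrightarrow> e \<notin> Y" if "e \<in> edges R" "j \<in> ?p e" for e
    proof -
      have "3 \<in> f ` ends R e" using v_end[OF that] \<open>f v = 3\<close> by force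
      then show ?thesis by (simp add: g0_def)
    qed
    then have "{e \<in> {e \<in> edges R. g0 e = 2}. j \<in> ?p e} = {e \<in> edges R - Y. j \<in> ?p e}"
      by blast
    then have "odd_at ?p (edges R - Y) j" using odd by (simp add: odd_at_def)
    moreover have "odd_at ?p (Y \<union> (edges R - Y)) j \<longleftrightarrow> odd_at ?p Y j \<noteq> odd_at ?p (edges R - Y) j"
      using finE Y(1) \<open>finite H\<close> by (intro odd_at_Un_disjoint) (auto intro: finite_subset)
    moreover have "Y \<union> (edges R - Y) = edges R" using Y(1) by (auto simp: H_def)
    ultimately show False using Y(2) total[OF j] by simp
  qed

  have T_connected: "\<forall>j\<in>T. \<forall>k\<in>T. (j, k) \<in> (adj ?p M)\<^sup>*"
  proof (intro ballI)
    fix j k assume jk: "j \<in> T" "k \<in> T"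
    \<comment> \<open>An edge of \<open>R[V\<^sub>i]\<close> shows by its presence that its ends are not isolated there.\<close>
    have row_M: "{e \<in> edges R. ends R e \<subseteq> row s i} \<subseteq> M"
    proof
      fix e assume e: "e \<in> {e \<in> edges R. ends R e \<subseteq> row s i}"
      have "special v" if v: "v \<in> ends R e" for v
      proof -
        obtain l where l: "v = (i, l)" "l \<in> {1..s}" using e v by (auto simp: row_def)
        have "e \<in> incident_edges (induced_subgraph R (row s i)) (i, l)"
          using e v l by (auto simp: incident_edges_def induced_subgraph_def)
        moreover have "finite (incident_edges (induced_subgraph R (row s i)) (i, l))"
          using finE by (auto simp: incident_edges_def induced_subgraph_def)
        ultimately have "\<not> iso l" by (auto simp: iso_def degree_def)
        then show ?thesis using a(3) l by (simp add: special_def)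
      qed
      then show "e \<in> M" using e by (auto simp: M_def)
    qed
    have "(j, k) \<in> (adj ?p {e \<in> edges R. ends R e \<subseteq> row s i})\<^sup>*"
      using nonisolated_connected[OF R assms(4)] T_range T_noniso jk unfolding iso_def by blast
    moreover have "adj ?p {e \<in> edges R. ends R e \<subseteq> row s i} \<subseteq> adj ?p M"
      using row_M unfolding adj_def by blast
    ultimately show "(j, k) \<in> (adj ?p M)\<^sup>*" using rtrancl_mono by blast
  qed
  have finM: "finite M" using finE by (simp add: M_def)
  obtain F where F: "F \<subseteq> M" "\<forall>j. odd_at ?p F j \<longleftrightarrow> j \<in> T"
    using join_exists[OF finM T T_connected] by auto

  define g where "g e = (if e \<in> F then 2 else g0 e)" for e
  have g_range: "g e \<in> {1, 2, 3}" for e by (simp add: g_def g0_def)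
  have g_proper: "f v \<noteq> g e" if "e \<in> edges R" "v \<in> ends R e" for e v
  proof (cases "e \<in> F")
    case True
    then have "f v = 1" using F(1) that f_1 unfolding M_def by blast
    then show ?thesis using True by (simp add: g_def)
  next
    case False
    then show ?thesis using g0_proper[OF that] by (simp add: g_def)
  qed
  let ?c = "\<lambda>c. {e \<in> edges R. g e = c}"
  have finF: "finite F" using F(1) finM by (auto intro: finite_subset)
  have FR: "F \<subseteq> edges R" using F(1) by (auto simp: M_def)
  have F3: "g0 e = 3" if "e \<in> F" for e using that F(1) g0_M by blast
  have even1: "\<not> odd_at ?p (?c 1) j" for j
  proof -
    have g0_1: "g0 e = 1 \<longleftrightarrow> e \<in> Y" for e by (simp add: g0_def)
    have "g e = 1 \<longleftrightarrow> e \<in> Y" for e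
    proof (cases "e \<in> F")
      case True
      then show ?thesis using F3[OF True] g0_1[of e] by (simp add: g_def)
    next
      case False
      then show ?thesis using g0_1[of e] by (simp add: g_def)
    qed
    then have "?c 1 = Y" using Y(1) by (auto simp: H_def)
    then show ?thesis using Y(2) by simp
  qed
  have even2: "\<not> odd_at ?p (?c 2) j" for j
  proof -
    have split2: "?c 2 = {e \<in> edges R. g0 e = 2} \<union> F" using FR by (auto simp: g_def)
    have "{e \<in> edges R. g0 e = 2} \<inter> F = {}" using F3 by force
    then have "odd_at ?p (?c 2) j \<longleftrightarrow> odd_at ?p {e \<in> edges R. g0 e = 2} j \<noteq> odd_at ?p F j"
      unfolding split2 using finE finF by (intro odd_at_Un_disjoint) auto
    then show ?thesis using F(2) by (simp add: T_def)
  qed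
  have even3: "\<not> odd_at ?p (?c 3) j" if "j \<in> {1..s}" for j
  proof -
    have "edges R = (?c 1 \<union> ?c 2) \<union> ?c 3" using g_range by blast
    moreover have "odd_at ?p ((?c 1 \<union> ?c 2) \<union> ?c 3) j \<longleftrightarrow>
        odd_at ?p (?c 1 \<union> ?c 2) j \<noteq> odd_at ?p (?c 3) j"
      using finE by (intro odd_at_Un_disjoint) auto
    moreover have "odd_at ?p (?c 1 \<union> ?c 2) j \<longleftrightarrow> odd_at ?p (?c 1) j \<noteq> odd_at ?p (?c 2) j"
      using finE by (intro odd_at_Un_disjoint) auto
    ultimately show ?thesis using total[OF that] even1 even2 by metis
  qed
  have even_col: "even (color_degree R g c (1, j) + color_degree R g c (2, j) + color_degree R g c (3, j))"
    if "c \<in> {1, 2, 3}" "j \<in> {1..s}" for c j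
  proof -
    have "\<not> odd_at ?p (?c c) j" using that even1 even2 even3 by blast
    then show ?thesis unfolding column_color_count[OF R that(2)] odd_at_def by simp
  qed
  have "amiable_coloring s R f g"
    unfolding amiable_coloring_def
  proof (intro conjI ballI impI)
    show "f ` verts R \<subseteq> {1, 2, 3}" using f_range by blast
    show "g ` edges R \<subseteq> {1, 2, 3}" using g_range by blast
  next
    fix v e assume "v \<in> verts R" "e \<in> incident_edges R v"
    then show "f v \<noteq> g e" using g_proper by (auto simp: incident_edges_def)
  next
    fix j v w assume "j \<in> {1..s}" "v \<in> column j" "w \<in> column j" "v \<noteq> w"
    then show "f v \<noteq> f w" by (rule f_inj)
  next
    fix c j :: nat assume "c \<in> {1, 2, 3}" "j \<in> {1..s}"
    then show "even (color_degree R g c (1, j) + color_degree R g c (2, j) + color_degree R g c (3, j))"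
      by (rule even_col)
  qed
  then show ?thesis by blast
qed

end
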